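(* Consider a queueing game with strategy simplex $\Delta\subset\mathbb{R}^k$ and stationary expected utility $\mathbf{u}:\Delta\to\mathbb{R}^k$ as described in the context. Assume that $\mathbf{u}(\mathbf{p})$ is continuous for all $\mathbf{p}\in\Delta$. Then a symmetric equilibrium strategy $\mathbf{p}^e\in\Delta$ exists, and this strategy satisfies $\mathbf{p}^e=\mathbf{f}(\mathbf{p}^e)$.
   Context: $k\ge2$ and $\Delta=\{\mathbf{p}\in\mathbb{R}^k:p_i\ge0,\ \sum_ip_i=1\}$ is the set of strategies over actions $a_1,\dots,a_k$. $\pi_\Delta$ is the Euclidean projection onto $\Delta$, and $'$ denotes transpose. Customers arrive to a service system according to a renewal process and each chooses an action according to the common strategy $\mathbf{p}$. For each $\mathbf{p}\in\Delta$ the system state seen by arrivals is assumed to have a stationary distribution; $X(\mathbf{p})$ is a random variable with this distribution. An arrival taking action $a_i$ at state $x$ with random outcome $y$ receives $v_i(x,y)$, and $\mathbf{u}(\mathbf{p})=\mathrm{E}_{\mathbf{p}}[\mathbf{v}(X(\mathbf{p}),Y)]\in\mathbb{R}^k$, $\mathbf{v}=(v_1,\dots,v_k)$, is assumed well defined (finite) for every $\mathbf{p}\in\Delta$. Apart from this, $\mathbf{u}$ is a general function $\Delta\to\mathbb{R}^k$. A strategy $\mathbf{p}\in\Delta$ is a symmetric Nash equilibrium if $\mathbf{p}\in\mathcal{BR}(\mathbf{p})=\arg\max_{\mathbf{q}\in\Delta}\mathbf{u}(\mathbf{p})'\mathbf{q}$. The surrogate best-response function is $\mathbf{f}:\Delta\to\Delta$,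 $\mathbf{f}(\mathbf{p})=\pi_\Delta(\mathbf{p}+\mathbf{u}(\mathbf{p}))$. *)

theory Defs
  imports "HOL-Probability.Probability"
begin

definition simplex_strategies :: "(real ^ 'k::finite) set"
  where "simplex_strategies = {p. (\<forall>i. 0 \<le> p $ i) \<and> (\<Sum>i\<in>UNIV. p $ i) = 1}"

text \<open>
  For every strategy \<open>p\<close> the probability space \<open>P p\<close> carries the system state \<open>X p\<close> seen by an
  arrival in stationarity and the random outcome \<open>Y\<close>. The renewal dynamics that produce
  the stationary law of \<open>X p\<close> are not modelled: the law is an arbitrary function of \<open>p\<close>.
  Likewise the joint law of \<open>X p\<close> and \<open>Y\<close> is unrestricted and may depend on \<open>p\<close>.
  The component \<open>v x y $ i\<close> is the payoff of an arrival that takes action \<open>i\<close>.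
\<close>

locale queueing_game =
  fixes S :: "'x measure"
    and T :: "'y measure"
    and P :: "real ^ 'k::finite \<Rightarrow> 'w measure"
    and X :: "real ^ 'k \<Rightarrow> 'w \<Rightarrow> 'x"
    and Y :: "'w \<Rightarrow> 'y"
    and v :: "'x \<Rightarrow> 'y \<Rightarrow> real ^ 'k"
  assumes prob_space_P: "p \<in> simplex_strategies \<Longrightarrow> prob_space (P p)"
    and X_measurable: "p \<in> simplex_strategies \<Longrightarrow> X p \<in> measurable (P p) S"
    and Y_measurable: "p \<in> simplex_strategies \<Longrightarrow> Y \<in> measurable (P p) T"
    and v_measurable: "(\<lambda>(x, y). v x y) \<in> borel_measurable (S \<Otimes>\<^sub>M T)"
    and payoff_integrable:
      "p \<in> simplex_strategies \<Longrightarrow> integrable (P p) (\<lambda>\<omega>. v (X p \<omega>) (Y \<omega>))"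

definition expected_utility ::
  "(real ^ 'k::finite \<Rightarrow> 'w measure) \<Rightarrow> (real ^ 'k \<Rightarrow> 'w \<Rightarrow> 'x) \<Rightarrow> ('w \<Rightarrow> 'y) \<Rightarrow>
   ('x \<Rightarrow> 'y \<Rightarrow> real ^ 'k) \<Rightarrow> real ^ 'k \<Rightarrow> real ^ 'k"
  where "expected_utility P X Y v p = (LINT \<omega>|P p. v (X p \<omega>) (Y \<omega>))"

definition best_responses ::
  "(real ^ 'k::finite \<Rightarrow> real ^ 'k) \<Rightarrow> real ^ 'k \<Rightarrow> (real ^ 'k) set"
  where "best_responses u p =
    {q. is_arg_max (\<lambda>q. u p \<bullet> q) (\<lambda>q. q \<in> simplex_strategies) q}"

definition symmetric_equilibrium ::
  "(real ^ 'k::finite \<Rightarrow> real ^ 'k) \<Rightarrow> real ^ 'k \<Rightarrow> bool"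
  where "symmetric_equilibrium u p \<longleftrightarrow> p \<in> simplex_strategies \<and> p \<in> best_responses u p"

definition surrogate_best_response ::
  "(real ^ 'k::finite \<Rightarrow> real ^ 'k) \<Rightarrow> real ^ 'k \<Rightarrow> real ^ 'k"
  where "surrogate_best_response u p = closest_point simplex_strategies (p + u p)"

end

theory Submission
  imports Defs
begin

text \<open>
  The strategy \<open>p\<close> is the projection of \<open>p + g\<close> onto a closed convex set exactly when \<open>g\<close> makes no
  acute angle with any feasible direction \<open>q - p\<close>, that is, when \<open>p\<close> maximises the linear function
  \<open>q \<mapsto> g \<bullet> q\<close> on the set (\<open>closest_point_displaced_iff\<close>). With \<open>g = u p\<close> and the simplex as the
  set, this says that the symmetric equilibria are exactly the fixed points of the surrogate best
  response (\<open>symmetric_equilibrium_iff_fixed_point\<close>). Unlike the best-response correspondence,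
  the surrogate is a single-valued map, and it is continuous because projections onto closed convex
  sets are nonexpansive; so Brouwer's theorem on the compact convex simplex yields a fixed point.
\<close>

lemma simplex_strategies_ne: "simplex_strategies \<noteq> ({} :: (real ^ 'k::finite) set)"
proof -
  fix i :: 'k
  have "axis i 1 \<in> simplex_strategies"
    by (auto simp: simplex_strategies_def axis_def)
  then show ?thesis by blast
qed

lemma convex_simplex_strategies: "convex (simplex_strategies :: (real ^ 'k::finite) set)"
  by (auto simp: convex_def simplex_strategies_def sum.distrib simp flip: sum_distrib_left)

lemma compact_simplex_strategies: "compact (simplex_strategies :: (real ^ 'k::finite) set)"
  unfolding compact_eq_bounded_closed
proof
  have "norm p \<le> 1" if "p \<in> simplex_strategies" for p :: "real ^ 'k"
    using norm_le_l1_cart[of p] that by (simp add: simplex_strategies_def)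
  then show "bounded (simplex_strategies :: (real ^ 'k) set)"
    by (auto simp: bounded_iff)
  show "closed (simplex_strategies :: (real ^ 'k) set)"
    unfolding simplex_strategies_def
    by (intro closed_Collect_conj closed_Collect_all closed_Collect_le closed_Collect_eq
        continuous_intros)
qed

text \<open>
  Expanding \<open>\<bar>p + g - q\<bar>\<^sup>2\<close> around \<open>\<bar>g\<bar>\<^sup>2\<close> leaves \<open>-2 g \<bullet> (q - p) + \<bar>q - p\<bar>\<^sup>2\<close>: the quadratic term only
  helps \<open>p\<close>, so the linear condition suffices. It is necessary because by convexity a direction
  with \<open>g \<bullet> (q - p) > 0\<close> can be followed for a short step, on which the linear term dominates.
\<close>

lemma closest_point_displaced_iff:
  fixes p g :: "'a::euclidean_space"
  assumes "convex S" "closed S" "p \<in> S"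
  shows "p = closest_point S (p + g) \<longleftrightarrow> (\<forall>q\<in>S. g \<bullet> q \<le> g \<bullet> p)"
proof
  assume fixed: "p = closest_point S (p + g)"
  show "\<forall>q\<in>S. g \<bullet> q \<le> g \<bullet> p"
  proof
    fix q assume "q \<in> S"
    then have "(p + g - p) \<bullet> (q - p) \<le> 0"
      using closest_point_dot[OF assms(1,2), of q "p + g"] unfolding fixed[symmetric] by blast
    then show "g \<bullet> q \<le> g \<bullet> p" by (simp add: inner_diff_right)
  qed
next
  assume max: "\<forall>q\<in>S. g \<bullet> q \<le> g \<bullet> p"
  have "dist (p + g) p \<le> dist (p + g) q" if "q \<in> S" for q
  proof -
    have "(norm g)\<^sup>2 \<le> (norm g)\<^sup>2 - 2 * (g \<bullet> (q - p)) + (norm (q - p))\<^sup>2"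
      using max that by (simp add: inner_diff_right add_increasing2)
    also have "\<dots> = (norm (g - (q - p)))\<^sup>2"
      by (simp add: power2_norm_eq_inner inner_diff_left inner_diff_right inner_commute)
    finally have "norm g \<le> norm (g - (q - p))"
      by (rule power2_le_imp_le) simp
    moreover have "p + g - q = g - (q - p)" by simp
    ultimately show ?thesis by (simp only: dist_norm add_diff_cancel_left')
  qed
  then show "p = closest_point S (p + g)"
    by (intro closest_point_unique assms ballI)
qed

lemma symmetric_equilibrium_iff_fixed_point:
  "symmetric_equilibrium u p \<longleftrightarrow> p \<in> simplex_strategies \<and> p = surrogate_best_response u p"
  using closest_point_displaced_iff[OF convex_simplex_strategies
      compact_imp_closed[OF compact_simplex_strategies], of p "u p"]
  unfolding symmetric_equilibrium_def best_responses_def surrogate_best_response_def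
    is_arg_max_linorder by blast

lemma symmetric_equilibrium_exists:
  fixes u :: "real ^ 'k::finite \<Rightarrow> real ^ 'k"
  assumes "continuous_on simplex_strategies u"
  shows "\<exists>p. symmetric_equilibrium u p"
proof -
  note simplex = convex_simplex_strategies compact_imp_closed[OF compact_simplex_strategies]
    simplex_strategies_ne
  have "continuous_on simplex_strategies (closest_point simplex_strategies \<circ> (\<lambda>p. p + u p))"
    by (intro continuous_on_compose continuous_on_closest_point simplex continuous_intros assms)
  then have "continuous_on simplex_strategies (surrogate_best_response u)"
    by (simp add: surrogate_best_response_def[abs_def] comp_def)
  moreover have "surrogate_best_response u \<in> simplex_strategies \<rightarrow> simplex_strategies"
    by (simp add: surrogate_best_response_def closest_point_in_set simplex)
  ultimately obtain p where "p \<in> simplex_strategies" "surrogate_best_response u p = p"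
    using brouwer[OF compact_simplex_strategies convex_simplex_strategies simplex_strategies_ne]
    by metis
  then show ?thesis
    unfolding symmetric_equilibrium_iff_fixed_point by metis
qed

theorem lemma3:
  fixes S :: "'x measure"
    and T :: "'y measure"
    and P :: "real ^ 'k::finite \<Rightarrow> 'w measure"
    and X :: "real ^ 'k \<Rightarrow> 'w \<Rightarrow> 'x"
    and Y :: "'w \<Rightarrow> 'y"
    and v :: "'x \<Rightarrow> 'y \<Rightarrow> real ^ 'k"
    and u :: "real ^ 'k \<Rightarrow> real ^ 'k"
  defines "u \<equiv> expected_utility P X Y v"
  assumes "CARD('k) \<ge> 2"
    and "queueing_game S T P X Y v"
    and "continuous_on simplex_strategies u"
  shows "(\<exists>p. symmetric_equilibrium u p) \<and>
    (\<forall>p. symmetric_equilibrium u p \<longrightarrow> p = surrogate_best_response u p)"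
  using symmetric_equilibrium_exists[OF assms(4)] symmetric_equilibrium_iff_fixed_point by blast

end
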